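(* Let $G$ be a three-dimensional abelian Lie group with a bi-invariant metric $\langle\,,\rangle$, and let $\alpha: I\subset\mathbb{R}\to G$ be a regular curve parametrized by arc length $s$, with Frenet vector fields $\{T,N,B\}$ and curvatures $\varkappa,\tau$. If the two-component spinor $\phi$ along $\alpha$ represents the triad $\{N,B,T\}$, then the Frenet equations $$\frac{dT}{ds}=\varkappa N,\qquad \frac{dN}{ds}=-\varkappa T+\tau B,\qquad \frac{dB}{ds}=-\tau N$$ are equivalent to the single spinor equation $$\frac{d\phi}{ds}=-i\,\frac{\tau}{2}\,\phi+\frac{\varkappa}{2}\,\widehat{\phi}.$$
   Context: Let $\mathfrak g$ be the Lie algebra of $G$ (left-invariant vector fields) and $D$ the Levi-Civita connection of the bi-invariant metric, so that $D_XY=\frac12[X,Y]$ for $X,Y\in\mathfrak g$ (here all brackets vanish). Fix an oriented orthonormal basis $\{X_1,X_2,X_3\}$ of $\mathfrak g$. A vector field along $\alpha$ is written $W=\sum_i w_iX_i$ with smooth functions $w_i:I\to\mathbb R$, and is identified with $(w_1,w_2,w_3)\in\mathbb R^3$. The notation $\frac{dW}{ds}=\dot W=\sum_i\dot w_iX_i$ means the componentwise derivative; in general $D_{\alpha'}W=\dot W+\frac12[T,W]$, where $T=\alpha'$ and the bracket is taken pointwise, $[W,Z]=\sum_{i,j}w_iz_j[X_i,X_j]$. The Frenet apparatus $(T,N,B,\varkappa,\tau)$ of the arc-length curve $\alpha$ consists of $T=\alpha'$, the orthonormal, positively oriented frame $\{T,N,B\}$ and the curvatures $\varkappa=\|\dot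 T\|$ (nonzero, so that the frame is defined) and $\tau$, for which $D_TT=\varkappa N$, $D_TN=-\varkappa T+\tau B$, $D_TB=-\tau N$. A spinor is a column $\phi=\begin{pmatrix}\phi_1\\ \phi_2\end{pmatrix}\in\mathbb C^2$; its mate is $\widehat\phi=\begin{pmatrix}-\overline{\phi_2}\\ \overline{\phi_1}\end{pmatrix}$. Let $\sigma=(\sigma_1,\sigma_2,\sigma_3)$ with $\sigma_1=\begin{pmatrix}1&0\\0&-1\end{pmatrix}$, $\sigma_2=\begin{pmatrix}i&0\\0&i\end{pmatrix}$, $\sigma_3=\begin{pmatrix}0&-1\\-1&0\end{pmatrix}$, and for spinors $\psi,\phi$ let $\psi^t\sigma\phi=(\psi^t\sigma_1\phi,\psi^t\sigma_2\phi,\psi^t\sigma_3\phi)\in\mathbb C^3$. A spinor $\phi$ along $\alpha$ (a differentiable function $I\to\mathbb C^2$) represents the triad $\{N,B,T\}$ if at each point $N+iB=\phi^t\sigma\phi$ and $T=-\widehat\phi^{\,t}\sigma\phi$, with $\overline{\phi}^{\,t}\phi=1$. Such a spinor is determined up to sign. *)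

theory Defs
  imports "HOL-Analysis.Analysis"
begin

section \<open>Smooth maps and smooth manifolds\<close>

text \<open>Derivatives are taken within the domain. This is the usual notion on open sets, and on
  relatively open subsets of a nondegenerate interval it gives one-sided derivatives at endpoints
  that belong to the interval. It is only used for such domains, where the derivative is unique.\<close>

fun Ck_on :: "nat \<Rightarrow> 'a::euclidean_space set \<Rightarrow> ('a \<Rightarrow> 'b::euclidean_space) \<Rightarrow> bool" where
  "Ck_on 0 U f \<longleftrightarrow> continuous_on U f"
| "Ck_on (Suc k) U f \<longleftrightarrow>
     f differentiable_on U \<and> (\<forall>v. Ck_on k U (\<lambda>x. frechet_derivative f (at x within U) v))"

definition smooth_on :: "'a::euclidean_space set \<Rightarrow> ('a \<Rightarrow> 'b::euclidean_space) \<Rightarrow> bool" where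
  "smooth_on U f \<longleftrightarrow> (\<forall>k. Ck_on k U f)"

type_synonym ('m, 'e) chart = "'m set \<times> ('m \<Rightarrow> 'e)"

text \<open>Only the values of a coordinate map on its chart domain matter. Atlases need not be maximal.\<close>

definition smooth_atlas :: "('m::topological_space, 'e::euclidean_space) chart set \<Rightarrow> bool" where
  "smooth_atlas A \<longleftrightarrow>
     (\<Union>(U, x)\<in>A. U) = UNIV \<and>
     (\<forall>(U, x)\<in>A. open U \<and> open (x ` U) \<and> (\<exists>y. homeomorphism U (x ` U) x y)) \<and>
     (\<forall>(U, x)\<in>A. \<forall>(V, y)\<in>A. smooth_on (x ` (U \<inter> V)) (y \<circ> inv_into U x))"

definition smooth_map ::
  "('m::topological_space, 'e::euclidean_space) chart set \<Rightarrow>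
   ('n::topological_space, 'f::euclidean_space) chart set \<Rightarrow> ('m \<Rightarrow> 'n) \<Rightarrow> bool" where
  "smooth_map A B f \<longleftrightarrow>
     continuous_on UNIV f \<and>
     (\<forall>(U, x)\<in>A. \<forall>(V, y)\<in>B. smooth_on (x ` (U \<inter> f -` V)) (y \<circ> f \<circ> inv_into U x))"

definition prod_atlas ::
  "('m, 'e) chart set \<Rightarrow> ('n, 'f) chart set \<Rightarrow> ('m \<times> 'n, 'e \<times> 'f) chart set" where
  "prod_atlas A B = (\<lambda>((U, x), (V, y)). (U \<times> V, map_prod x y)) ` (A \<times> B)"

definition smooth_fun ::
  "('m::topological_space, 'e::euclidean_space) chart set \<Rightarrow> ('m \<Rightarrow> real) \<Rightarrow> bool" where
  "smooth_fun A f \<longleftrightarrow> smooth_map A {(UNIV, \<lambda>t::real. t)} f"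

definition smooth_curve ::
  "('m::topological_space, 'e::euclidean_space) chart set \<Rightarrow> real set \<Rightarrow> (real \<Rightarrow> 'm) \<Rightarrow> bool" where
  "smooth_curve A I \<alpha> \<longleftrightarrow>
     continuous_on I \<alpha> \<and> (\<forall>(U, x)\<in>A. smooth_on {s\<in>I. \<alpha> s \<in> U} (x \<circ> \<alpha>))"

section \<open>Tangent vectors and Riemannian metrics\<close>

text \<open>Tangent vectors are derivations of the algebra of smooth functions, extended by zero to
  functions that are not smooth so that equal derivations are equal as HOL functions.\<close>

type_synonym 'm tangent = "('m \<Rightarrow> real) \<Rightarrow> real"

definition tangent_space ::
  "('m::topological_space, 'e::euclidean_space) chart set \<Rightarrow> 'm \<Rightarrow> 'm tangent set" where
  "tangent_space A p = {v.
     (\<forall>f. \<not> smooth_fun A f \<longrightarrow> v f = 0) \<and>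
     (\<forall>f g. smooth_fun A f \<longrightarrow> smooth_fun A g \<longrightarrow>
        v (\<lambda>q. f q + g q) = v f + v g \<and>
        v (\<lambda>q. f q * g q) = v f * g p + f p * v g) \<and>
     (\<forall>c f. smooth_fun A f \<longrightarrow> v (\<lambda>q. c * f q) = c * v f)}"

definition velocity ::
  "('m::topological_space, 'e::euclidean_space) chart set \<Rightarrow> real set \<Rightarrow> (real \<Rightarrow> 'm) \<Rightarrow>
   real \<Rightarrow> 'm tangent" where
  "velocity A I \<alpha> s =
     (\<lambda>f. if smooth_fun A f then vector_derivative (f \<circ> \<alpha>) (at s within I) else 0)"

text \<open>The differential of a diffeomorphism \<open>h\<close>; for these, \<open>f \<circ> h\<close> is smooth iff \<open>f\<close> is.\<close>

definition pushforward :: "('m \<Rightarrow> 'm) \<Rightarrow> 'm tangent \<Rightarrow> 'm tangent" where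
  "pushforward h v = (\<lambda>f. v (f \<circ> h))"

definition smooth_vector_field ::
  "('m::topological_space, 'e::euclidean_space) chart set \<Rightarrow> ('m \<Rightarrow> 'm tangent) \<Rightarrow> bool" where
  "smooth_vector_field A X \<longleftrightarrow>
     (\<forall>p. X p \<in> tangent_space A p) \<and> (\<forall>f. smooth_fun A f \<longrightarrow> smooth_fun A (\<lambda>p. X p f))"

definition riemannian_metric ::
  "('m::topological_space, 'e::euclidean_space) chart set \<Rightarrow>
   ('m \<Rightarrow> 'm tangent \<Rightarrow> 'm tangent \<Rightarrow> real) \<Rightarrow> bool" where
  "riemannian_metric A m \<longleftrightarrow>
     (\<forall>p. \<forall>u\<in>tangent_space A p. \<forall>v\<in>tangent_space A p. \<forall>w\<in>tangent_space A p. \<forall>a b.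
        m p (\<lambda>f. a * u f + b * v f) w = a * m p u w + b * m p v w) \<and>
     (\<forall>p. \<forall>v\<in>tangent_space A p. \<forall>w\<in>tangent_space A p. m p v w = m p w v) \<and>
     (\<forall>p. \<forall>v\<in>tangent_space A p. v \<noteq> (\<lambda>f. 0) \<longrightarrow> 0 < m p v v) \<and>
     (\<forall>X Y. smooth_vector_field A X \<longrightarrow> smooth_vector_field A Y \<longrightarrow>
        smooth_fun A (\<lambda>p. m p (X p) (Y p)))"

section \<open>Lie groups\<close>

text \<open>The group is written additively, also when it is not assumed to be commutative. Its
  dimension is that of the model space \<open>'e\<close>.\<close>

definition lie_group ::
  "('g::{topological_group_add, t2_space, second_countable_topology}, 'e::euclidean_space)
     chart set \<Rightarrow> bool" where
  "lie_group A \<longleftrightarrow>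
     smooth_atlas A \<and>
     smooth_map (prod_atlas A A) A (\<lambda>(p, q). p + q) \<and>
     smooth_map A A (\<lambda>p. - p)"

definition lie_algebra ::
  "('g::{topological_group_add, t2_space, second_countable_topology}, 'e::euclidean_space)
     chart set \<Rightarrow> ('g \<Rightarrow> 'g tangent) set" where
  "lie_algebra A = {X. smooth_vector_field A X \<and>
     (\<forall>g p. pushforward (\<lambda>q. g + q) (X p) = X (g + p))}"

definition bi_invariant_metric ::
  "('g::{topological_group_add, t2_space, second_countable_topology}, 'e::euclidean_space)
     chart set \<Rightarrow> ('g \<Rightarrow> 'g tangent \<Rightarrow> 'g tangent \<Rightarrow> real) \<Rightarrow> bool" where
  "bi_invariant_metric A m \<longleftrightarrow>
     riemannian_metric A m \<and>
     (\<forall>g p. \<forall>v\<in>tangent_space A p. \<forall>w\<in>tangent_space A p.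
        m (g + p) (pushforward (\<lambda>q. g + q) v) (pushforward (\<lambda>q. g + q) w) = m p v w \<and>
        m (p + g) (pushforward (\<lambda>q. q + g) v) (pushforward (\<lambda>q. q + g) w) = m p v w)"

text \<open>The inner product of the Lie algebra is the metric at the identity. The ordered basis also
  fixes the orientation: it is positively oriented by definition.\<close>

definition orthonormal_basis ::
  "('g::{topological_group_add, t2_space, second_countable_topology}, real^3) chart set \<Rightarrow>
   ('g \<Rightarrow> 'g tangent \<Rightarrow> 'g tangent \<Rightarrow> real) \<Rightarrow> (3 \<Rightarrow> 'g \<Rightarrow> 'g tangent) \<Rightarrow> bool" where
  "orthonormal_basis A m X \<longleftrightarrow>
     (\<forall>i. X i \<in> lie_algebra A) \<and>
     (\<forall>i j. m 0 (X i 0) (X j 0) = (if i = j then 1 else 0)) \<and>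
     (\<forall>Y\<in>lie_algebra A. \<exists>c. \<forall>p f. Y p f = (\<Sum>i\<in>UNIV. c i * X i p f))"

section \<open>Curves and frames\<close>

text \<open>The vector field along \<open>\<alpha>\<close> with component function \<open>w\<close>. Vector fields along \<open>\<alpha>\<close> are given
  by their components, and \<open>dW/ds\<close> is the derivative of the component function.\<close>

definition along ::
  "(3 \<Rightarrow> 'g \<Rightarrow> 'g tangent) \<Rightarrow> (real \<Rightarrow> 'g) \<Rightarrow> (real \<Rightarrow> real^3) \<Rightarrow> real \<Rightarrow> 'g tangent" where
  "along X \<alpha> w s = (\<lambda>f. \<Sum>i\<in>UNIV. w s $ i * X i (\<alpha> s) f)"

definition arc_length_curve ::
  "('m::topological_space, 'e::euclidean_space) chart set \<Rightarrow>
   ('m \<Rightarrow> 'm tangent \<Rightarrow> 'm tangent \<Rightarrow> real) \<Rightarrow> real set \<Rightarrow> (real \<Rightarrow> 'm) \<Rightarrow> bool" where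
  "arc_length_curve A m I \<alpha> \<longleftrightarrow>
     smooth_curve A I \<alpha> \<and>
     (\<forall>s\<in>I. m (\<alpha> s) (velocity A I \<alpha> s) (velocity A I \<alpha> s) = 1)"

text \<open>The data \<open>(T, N, B, \<kappa>)\<close> of the Frenet apparatus without the Frenet equations themselves,
  which are kept separate because they are one side of an equivalence: a smooth, orthonormal,
  positively oriented frame with \<open>T = \<alpha>'\<close>, and the nonzero curvature \<open>\<kappa> = \<parallel>dT/ds\<parallel>\<close>.\<close>

definition frenet_frame ::
  "('g::topological_space, real^3) chart set \<Rightarrow>
   ('g \<Rightarrow> 'g tangent \<Rightarrow> 'g tangent \<Rightarrow> real) \<Rightarrow> (3 \<Rightarrow> 'g \<Rightarrow> 'g tangent) \<Rightarrow>
   real set \<Rightarrow> (real \<Rightarrow> 'g) \<Rightarrow>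
   (real \<Rightarrow> real^3) \<Rightarrow> (real \<Rightarrow> real^3) \<Rightarrow> (real \<Rightarrow> real^3) \<Rightarrow> (real \<Rightarrow> real) \<Rightarrow> bool" where
  "frenet_frame A m X I \<alpha> T N B \<kappa> \<longleftrightarrow>
     smooth_on I T \<and> smooth_on I N \<and> smooth_on I B \<and>
     (\<forall>s\<in>I.
        velocity A I \<alpha> s = along X \<alpha> T s \<and>
        m (\<alpha> s) (along X \<alpha> T s) (along X \<alpha> T s) = 1 \<and>
        m (\<alpha> s) (along X \<alpha> N s) (along X \<alpha> N s) = 1 \<and>
        m (\<alpha> s) (along X \<alpha> B s) (along X \<alpha> B s) = 1 \<and>
        m (\<alpha> s) (along X \<alpha> T s) (along X \<alpha> N s) = 0 \<and>
        m (\<alpha> s) (along X \<alpha> T s) (along X \<alpha> B s) = 0 \<and>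
        m (\<alpha> s) (along X \<alpha> N s) (along X \<alpha> B s) = 0 \<and>
        det (vector [T s, N s, B s] :: real^3^3) > 0 \<and>
        (let dT = along X \<alpha> (\<lambda>r. vector_derivative T (at r within I)) s
         in \<kappa> s = sqrt (m (\<alpha> s) dT dT)) \<and>
        \<kappa> s \<noteq> 0)"

definition frenet_equations ::
  "real set \<Rightarrow> (real \<Rightarrow> real^3) \<Rightarrow> (real \<Rightarrow> real^3) \<Rightarrow> (real \<Rightarrow> real^3) \<Rightarrow>
   (real \<Rightarrow> real) \<Rightarrow> (real \<Rightarrow> real) \<Rightarrow> bool" where
  "frenet_equations I T N B \<kappa> \<tau> \<longleftrightarrow> (\<forall>s\<in>I.
     (T has_vector_derivative \<kappa> s *\<^sub>R N s) (at s within I) \<and>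
     (N has_vector_derivative - \<kappa> s *\<^sub>R T s + \<tau> s *\<^sub>R B s) (at s within I) \<and>
     (B has_vector_derivative - \<tau> s *\<^sub>R N s) (at s within I))"

section \<open>Spinors\<close>

definition mate :: "complex^2 \<Rightarrow> complex^2" where
  "mate \<phi> = vector [- cnj (\<phi> $ 2), cnj (\<phi> $ 1)]"

definition sigma1 :: "complex^2^2" where
  "sigma1 = vector [vector [1, 0], vector [0, - 1]]"

definition sigma2 :: "complex^2^2" where
  "sigma2 = vector [vector [\<i>, 0], vector [0, \<i>]]"

definition sigma3 :: "complex^2^2" where
  "sigma3 = vector [vector [0, - 1], vector [- 1, 0]]"

text \<open>\<open>\<psi>\<^sup>t M \<phi>\<close>, without complex conjugation.\<close>

definition bilin :: "complex^2 \<Rightarrow> complex^2^2 \<Rightarrow> complex^2 \<Rightarrow> complex" where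
  "bilin \<psi> M \<phi> = (\<Sum>i\<in>UNIV. \<psi> $ i * (M *v \<phi>) $ i)"

definition sigma_form :: "complex^2 \<Rightarrow> complex^2 \<Rightarrow> complex^3" where
  "sigma_form \<psi> \<phi> = vector [bilin \<psi> sigma1 \<phi>, bilin \<psi> sigma2 \<phi>, bilin \<psi> sigma3 \<phi>]"

definition represents_triad ::
  "real set \<Rightarrow> (real \<Rightarrow> complex^2) \<Rightarrow>
   (real \<Rightarrow> real^3) \<Rightarrow> (real \<Rightarrow> real^3) \<Rightarrow> (real \<Rightarrow> real^3) \<Rightarrow> bool" where
  "represents_triad I \<phi> N B T \<longleftrightarrow> (\<forall>s\<in>I.
     (\<chi> k. complex_of_real (N s $ k) + \<i> * complex_of_real (B s $ k)) = sigma_form (\<phi> s) (\<phi> s) \<and>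
     (\<chi> k. complex_of_real (T s $ k)) = - sigma_form (mate (\<phi> s)) (\<phi> s) \<and>
     (\<Sum>i\<in>UNIV. cnj (\<phi> s $ i) * \<phi> s $ i) = 1)"

definition spinor_equation ::
  "real set \<Rightarrow> (real \<Rightarrow> complex^2) \<Rightarrow> (real \<Rightarrow> real) \<Rightarrow> (real \<Rightarrow> real) \<Rightarrow> bool" where
  "spinor_equation I \<phi> \<kappa> \<tau> \<longleftrightarrow> (\<forall>s\<in>I.
     (\<phi> has_vector_derivative
        (- \<i> * complex_of_real (\<tau> s / 2)) *s \<phi> s + complex_of_real (\<kappa> s / 2) *s mate (\<phi> s))
       (at s within I))"

end

theory Submission
  imports Defs
begin

text \<open>Write \<open>F = N + iB\<close>. Since \<open>F = \<phi>\<^sup>t\<sigma>\<phi>\<close> and \<open>T = - (mate \<phi>)\<^sup>t\<sigma>\<phi>\<close> along the curve, and the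
  \<open>\<sigma>\<^sub>k\<close> are symmetric matrices, the product rule gives \<open>F' = 2 \<phi>\<^sup>t\<sigma>\<phi>'\<close> (\<open>sigma_form_commute\<close>).
  If \<open>R\<close> is the right-hand side of the spinor equation, then
  \<open>2 \<phi>\<^sup>t\<sigma>R = - i\<tau> F - \<kappa> T\<close>, which is exactly \<open>N' + iB'\<close> as prescribed by the Frenet equations
  (\<open>sigma_form_spinor_rhs\<close>). For \<open>\<phi> \<noteq> 0\<close> the map \<open>\<psi> \<mapsto> \<phi>\<^sup>t\<sigma>\<psi>\<close> is injective
  (\<open>sigma_form_cancel\<close>), so the Frenet equations for \<open>N\<close> and \<open>B\<close> force \<open>\<phi>' = R\<close>. Conversely, \<open>\<phi>' = R\<close>
  gives the equations for \<open>N\<close> and \<open>B\<close> by taking real and imaginary parts, and the one for \<open>T\<close>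
  by differentiating \<open>- (mate \<phi>)\<^sup>t\<sigma>\<phi>\<close> (\<open>sigma_form_mate_spinor_rhs\<close>).

  The group enters only through the components with respect to a left-invariant basis, so the
  argument takes place in \<open>\<real>\<^sup>3\<close> and \<open>\<complex>\<^sup>2\<close>.\<close>

text \<open>The complex vector \<open>u + iv\<close> with real part \<open>u\<close> and imaginary part \<open>v\<close>.\<close>

definition complex_vec :: "real^'n \<Rightarrow> real^'n \<Rightarrow> complex^'n" where
  "complex_vec u v = (\<chi> k. Complex (u $ k) (v $ k))"

text \<open>The right-hand side of the spinor equation at a single parameter value.\<close>

definition spinor_rhs :: "real \<Rightarrow> real \<Rightarrow> complex^2 \<Rightarrow> complex^2" where
  "spinor_rhs \<kappa> \<tau> \<phi> =
     (- \<i> * complex_of_real (\<tau> / 2)) *s \<phi> + complex_of_real (\<kappa> / 2) *s mate \<phi>"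

lemma has_vector_derivative_complex_vec_iff:
  fixes u v :: "real \<Rightarrow> real^'n"
  shows "((\<lambda>s. complex_vec (u s) (v s)) has_vector_derivative complex_vec u' v') F \<longleftrightarrow>
    (u has_vector_derivative u') F \<and> (v has_vector_derivative v') F"
proof
  assume *: "((\<lambda>s. complex_vec (u s) (v s)) has_vector_derivative complex_vec u' v') F"
  have re: "bounded_linear (\<lambda>w::complex^'n. \<chi> k. Re (w $ k))"
    and im: "bounded_linear (\<lambda>w::complex^'n. \<chi> k. Im (w $ k))"
    by (auto simp: linear_conv_bounded_linear[symmetric] vec_eq_iff intro!: linearI)
  show "(u has_vector_derivative u') F \<and> (v has_vector_derivative v') F"
    using bounded_linear.has_vector_derivative[OF re *]
      bounded_linear.has_vector_derivative[OF im *]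
    by (simp add: complex_vec_def)
next
  assume *: "(u has_vector_derivative u') F \<and> (v has_vector_derivative v') F"
  have left: "bounded_linear (\<lambda>w::real^'n. complex_vec w 0)"
    and right: "bounded_linear (\<lambda>w::real^'n. complex_vec 0 w)"
    by (auto simp: linear_conv_bounded_linear[symmetric] vec_eq_iff complex_vec_def complex_eq_iff
        intro!: linearI)
  have split: "complex_vec a b = complex_vec a 0 + complex_vec 0 b" for a b :: "real^'n"
    by (simp add: complex_vec_def vec_eq_iff complex_eq_iff)
  show "((\<lambda>s. complex_vec (u s) (v s)) has_vector_derivative complex_vec u' v') F"
    using has_vector_derivative_add[OF
        bounded_linear.has_vector_derivative[OF left conjunct1[OF *]]
        bounded_linear.has_vector_derivative[OF right conjunct2[OF *]]]
    by (simp add: split[symmetric])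
qed

lemma mate_nth [simp]: "mate \<phi> $ 1 = - cnj (\<phi> $ 2)" "mate \<phi> $ 2 = cnj (\<phi> $ 1)"
  by (simp_all add: mate_def)

lemma sigma_form_nth [simp]:
  "sigma_form \<psi> \<phi> $ 1 = \<psi> $ 1 * \<phi> $ 1 - \<psi> $ 2 * \<phi> $ 2"
  "sigma_form \<psi> \<phi> $ 2 = \<i> * (\<psi> $ 1 * \<phi> $ 1 + \<psi> $ 2 * \<phi> $ 2)"
  "sigma_form \<psi> \<phi> $ 3 = - (\<psi> $ 1 * \<phi> $ 2 + \<psi> $ 2 * \<phi> $ 1)"
  by (simp_all add: sigma_form_def bilin_def sigma1_def sigma2_def sigma3_def
      matrix_vector_mult_def sum_2 algebra_simps)

lemma sigma_form_commute: "sigma_form \<psi> \<phi> = sigma_form \<phi> \<psi>"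
  by (simp add: vec_eq_iff forall_3 algebra_simps)

lemma bounded_bilinear_sigma_form: "bounded_bilinear sigma_form"
  by (auto simp: bilinear_conv_bounded_bilinear[symmetric] bilinear_def vec_eq_iff forall_3
      algebra_simps intro!: linearI)

lemma bounded_linear_mate: "bounded_linear mate"
  by (auto simp: linear_conv_bounded_linear[symmetric] vec_eq_iff forall_2 intro!: linearI)

text \<open>The first two components of \<open>\<phi>\<^sup>t\<sigma>\<psi>\<close> determine \<open>\<phi>\<^sub>1\<psi>\<^sub>1\<close> and \<open>\<phi>\<^sub>2\<psi>\<^sub>2\<close>; if one of the \<open>\<phi>\<^sub>i\<close>
  vanishes, the third component determines the remaining component of \<open>\<psi>\<close>.\<close>

lemma sigma_form_cancel:
  assumes "sigma_form \<phi> \<psi> = sigma_form \<phi> \<psi>'" and "\<phi> \<noteq> 0"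
  shows "\<psi> = \<psi>'"
proof -
  have diff: "\<phi> $ 1 * \<psi> $ 1 - \<phi> $ 2 * \<psi> $ 2 = \<phi> $ 1 * \<psi>' $ 1 - \<phi> $ 2 * \<psi>' $ 2"
    and sum: "\<phi> $ 1 * \<psi> $ 1 + \<phi> $ 2 * \<psi> $ 2 = \<phi> $ 1 * \<psi>' $ 1 + \<phi> $ 2 * \<psi>' $ 2"
    and mixed: "\<phi> $ 1 * \<psi> $ 2 + \<phi> $ 2 * \<psi> $ 1 = \<phi> $ 1 * \<psi>' $ 2 + \<phi> $ 2 * \<psi>' $ 1"
    using arg_cong[OF assms(1), of "\<lambda>v. v $ 1"] arg_cong[OF assms(1), of "\<lambda>v. v $ 2"]
      arg_cong[OF assms(1), of "\<lambda>v. - v $ 3"] by (simp_all add: add.commute)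
  have "2 * (\<phi> $ 1 * \<psi> $ 1) = 2 * (\<phi> $ 1 * \<psi>' $ 1)"
    and "2 * (\<phi> $ 2 * \<psi> $ 2) = 2 * (\<phi> $ 2 * \<psi>' $ 2)"
    using diff sum by algebra+
  then have "\<phi> $ 1 * \<psi> $ 1 = \<phi> $ 1 * \<psi>' $ 1" and "\<phi> $ 2 * \<psi> $ 2 = \<phi> $ 2 * \<psi>' $ 2"
    by simp_all
  moreover have "\<phi> $ 1 \<noteq> 0 \<or> \<phi> $ 2 \<noteq> 0"
    using assms(2) by (simp add: vec_eq_iff forall_2)
  ultimately have "\<psi> $ 1 = \<psi>' $ 1 \<and> \<psi> $ 2 = \<psi>' $ 2"
    using mixed by auto
  then show ?thesis
    by (simp add: vec_eq_iff forall_2)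
qed

lemma sigma_form_spinor_rhs:
  assumes "complex_vec N B = sigma_form \<phi> \<phi>" and "complex_vec T 0 = - sigma_form (mate \<phi>) \<phi>"
  shows "sigma_form \<phi> (spinor_rhs \<kappa> \<tau> \<phi>) + sigma_form (spinor_rhs \<kappa> \<tau> \<phi>) \<phi> =
    complex_vec (- \<kappa> *\<^sub>R T + \<tau> *\<^sub>R B) (- \<tau> *\<^sub>R N)"
proof -
  have "complex_vec (- \<kappa> *\<^sub>R T + \<tau> *\<^sub>R B) (- \<tau> *\<^sub>R N) =
      (- \<i> * of_real \<tau>) *s complex_vec N B - of_real \<kappa> *s complex_vec T 0"
    by (simp add: complex_vec_def vec_eq_iff complex_eq_iff)
  also have "\<dots> = sigma_form \<phi> (spinor_rhs \<kappa> \<tau> \<phi>) + sigma_form (spinor_rhs \<kappa> \<tau> \<phi>) \<phi>"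
    unfolding assms spinor_rhs_def by (simp add: vec_eq_iff forall_3 field_simps)
  finally show ?thesis ..
qed

text \<open>The components of the spinor equation along \<open>\<phi>\<close> cancel here because their coefficient is
  imaginary; the others combine to the real part of \<open>\<kappa> (N + iB)\<close>.\<close>

lemma sigma_form_mate_spinor_rhs:
  assumes "complex_vec N B = sigma_form \<phi> \<phi>"
  shows "- (sigma_form (mate \<phi>) (spinor_rhs \<kappa> \<tau> \<phi>) + sigma_form (mate (spinor_rhs \<kappa> \<tau> \<phi>)) \<phi>) =
    complex_vec (\<kappa> *\<^sub>R N) 0"
proof -
  have "complex_vec (\<kappa> *\<^sub>R N) 0 =
      (of_real \<kappa> / 2) *s (complex_vec N B + (\<chi> k. cnj (complex_vec N B $ k)))"
    by (simp add: complex_vec_def vec_eq_iff complex_eq_iff)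
  also have "\<dots> =
      - (sigma_form (mate \<phi>) (spinor_rhs \<kappa> \<tau> \<phi>) + sigma_form (mate (spinor_rhs \<kappa> \<tau> \<phi>)) \<phi>)"
    unfolding assms spinor_rhs_def by (simp add: vec_eq_iff forall_3 field_simps)
  finally show ?thesis ..
qed

theorem corollary3p3:
  fixes A :: "('g::{topological_ab_group_add, t2_space, second_countable_topology}, real^3) chart set"
    and m :: "'g \<Rightarrow> 'g tangent \<Rightarrow> 'g tangent \<Rightarrow> real"
    and X :: "3 \<Rightarrow> 'g \<Rightarrow> 'g tangent"
    and I :: "real set"
    and \<alpha> :: "real \<Rightarrow> 'g"
    and T N B :: "real \<Rightarrow> real^3"
    and \<kappa> \<tau> :: "real \<Rightarrow> real"
    and \<phi> :: "real \<Rightarrow> complex^2"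
  assumes "lie_group A"
    and "bi_invariant_metric A m"
    and "orthonormal_basis A m X"
    and "is_interval I" and "interior I \<noteq> {}"
    and "arc_length_curve A m I \<alpha>"
    and "frenet_frame A m X I \<alpha> T N B \<kappa>"
    and "\<phi> differentiable_on I"
    and "represents_triad I \<phi> N B T"
  shows "frenet_equations I T N B \<kappa> \<tau> \<longleftrightarrow> spinor_equation I \<phi> \<kappa> \<tau>"
proof -
  note I = \<open>is_interval I\<close> \<open>interior I \<noteq> {}\<close>
  have F: "complex_vec (N s) (B s) = sigma_form (\<phi> s) (\<phi> s)"
    and T: "complex_vec (T s) 0 = - sigma_form (mate (\<phi> s)) (\<phi> s)"
    and nonzero: "\<phi> s \<noteq> 0" if "s \<in> I" for s
    using \<open>represents_triad I \<phi> N B T\<close> that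
    by (auto simp: represents_triad_def complex_vec_def Complex_eq complex_of_real_def[symmetric])
  have spinor: "spinor_equation I \<phi> \<kappa> \<tau> \<longleftrightarrow>
      (\<forall>s\<in>I. (\<phi> has_vector_derivative spinor_rhs (\<kappa> s) (\<tau> s) (\<phi> s)) (at s within I))"
    by (simp add: spinor_equation_def spinor_rhs_def)
  have derivF: "((\<lambda>s. complex_vec (N s) (B s)) has_vector_derivative
      sigma_form (\<phi> s) D + sigma_form D (\<phi> s)) (at s within I)"
    if "s \<in> I" "(\<phi> has_vector_derivative D) (at s within I)" for s D
    by (rule has_vector_derivative_transform[OF that(1) F
          bounded_bilinear.has_vector_derivative[OF bounded_bilinear_sigma_form that(2,2)]])
  have derivT: "((\<lambda>s. complex_vec (T s) 0) has_vector_derivative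
      - (sigma_form (mate (\<phi> s)) D + sigma_form (mate D) (\<phi> s))) (at s within I)"
    if "s \<in> I" "(\<phi> has_vector_derivative D) (at s within I)" for s D
    by (rule has_vector_derivative_transform[OF that(1) T has_vector_derivative_minus[OF
            bounded_bilinear.has_vector_derivative[OF bounded_bilinear_sigma_form
              bounded_linear.has_vector_derivative[OF bounded_linear_mate that(2)] that(2)]]])
  show ?thesis
  proof
    assume frenet: "frenet_equations I T N B \<kappa> \<tau>"
    show "spinor_equation I \<phi> \<kappa> \<tau>"
      unfolding spinor
    proof
      fix s assume s: "s \<in> I"
      let ?R = "spinor_rhs (\<kappa> s) (\<tau> s) (\<phi> s)"
      obtain D where D: "(\<phi> has_vector_derivative D) (at s within I)"
        using \<open>\<phi> differentiable_on I\<close> s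
        by (auto simp: differentiable_on_def vector_derivative_works)
      \<comment> \<open>Derivatives within \<open>I\<close> are unique because \<open>I\<close> is a nondegenerate interval.\<close>
      have "I \<noteq> {x}" for x
        using I(2) by auto
      then have limit: "at s within I \<noteq> bot"
        using connected_imp_perfect[OF is_interval_connected[OF I(1)] s]
        by (auto simp: trivial_limit_within)
      have "((\<lambda>s. complex_vec (N s) (B s)) has_vector_derivative
          complex_vec (- \<kappa> s *\<^sub>R T s + \<tau> s *\<^sub>R B s) (- \<tau> s *\<^sub>R N s)) (at s within I)"
        using frenet s
        by (auto simp only: frenet_equations_def has_vector_derivative_complex_vec_iff)
      from vector_derivative_unique_within[OF limit derivF[OF s D] this]
      have "sigma_form (\<phi> s) D + sigma_form D (\<phi> s) =
          sigma_form (\<phi> s) ?R + sigma_form ?R (\<phi> s)"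
        by (simp only: sigma_form_spinor_rhs[OF F[OF s] T[OF s]])
      then have "(2::real) *\<^sub>R sigma_form (\<phi> s) D = (2::real) *\<^sub>R sigma_form (\<phi> s) ?R"
        by (simp only: sigma_form_commute[of _ "\<phi> s"] scaleR_2)
      then have "D = ?R"
        using sigma_form_cancel nonzero[OF s] by simp
      with D show "(\<phi> has_vector_derivative ?R) (at s within I)"
        by simp
    qed
  next
    assume "spinor_equation I \<phi> \<kappa> \<tau>"
    then have D: "(\<phi> has_vector_derivative spinor_rhs (\<kappa> s) (\<tau> s) (\<phi> s)) (at s within I)"
      if "s \<in> I" for s
      using that by (simp add: spinor)
    show "frenet_equations I T N B \<kappa> \<tau>"
      unfolding frenet_equations_def
    proof
      fix s assume s: "s \<in> I"
      show "(T has_vector_derivative \<kappa> s *\<^sub>R N s) (at s within I) \<and>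
        (N has_vector_derivative - \<kappa> s *\<^sub>R T s + \<tau> s *\<^sub>R B s) (at s within I) \<and>
        (B has_vector_derivative - \<tau> s *\<^sub>R N s) (at s within I)"
        using derivF[OF s D[OF s]] derivT[OF s D[OF s]]
        unfolding sigma_form_spinor_rhs[OF F[OF s] T[OF s]] sigma_form_mate_spinor_rhs[OF F[OF s]]
          has_vector_derivative_complex_vec_iff
        by blast
    qed
  qed
qed

end
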